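(* Let $\nu$ be a (possibly infinite) cardinal number of gods. A $\nu$ gods puzzle is solvable if and only if the number (cardinality) of random gods is strictly less than the number (cardinality) of non-random gods.
   Context: A $\nu$ gods puzzle: regard $\nu$ as an ordinal; there are distinguishable gods $\gamma_\alpha$, $\alpha<\nu$, each of exactly one type: truthful ($\mathcal{T}$), lying ($\mathcal{F}$) or random ($\mathcal{R}$); non-random means truthful or lying. The cardinal numbers of random, of truthful and of lying gods are fixed and known to the solver, but which god has which type is not. The solver asks yes/no questions, each directed at one god of the solver's choice. There is no restriction on the number of questions: the questions may form an infinite (transfinite, well-ordered) sequence, each chosen adaptively from all earlier answers. The gods understand the questions but answer with one of two words, one of which is `$\chi$'. One of the two words means yes and the other means no, and the solver does not know which. A question is any yes/no question having a definite truth value given the actual state (the types of the gods and the meaning of $\chi$), including hypothetical questions to a non-random god about how that god would answer some other question. A truthful god gives the word for the true answer, a lying god gives the word for the opposite of the true answer, and a random god answers randomly, so that either word may be given at any time. The puzzle is solvable if there is an adaptive strategy of questions after which the type of every god is determined with certainty, whatever the actual assignment of types consistent with the known cardinalities, whatever the meaning of $\chi$, and whatever answers the random gods happen to give. The solver need not determine the meaning of $\chi$.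
   Formalization: At least one god is assumed to be non-random: if all gods are random (or there are none), the known cardinalities already give every god's type without questions, so the puzzle is solvable although the number of random gods is not less than that of non-random gods. *)

theory Defs
  imports Main
begin

unbundle cardinal_syntax

datatype god_type = Truthful | Lying | Random

text \<open>The gods are the elements of the type \<open>'g\<close>, so their number \<open>\<nu>\<close> is the cardinality of
  \<^term>\<open>UNIV :: 'g set\<close>.\<close>

datatype 'g state = State (type_of: "'g \<Rightarrow> god_type") (chi_means_yes: bool)

datatype word = Chi | Other

text \<open>A question is identified with its truth value as a function of the actual state. This covers
  hypothetical questions such as ``would you answer \<open>\<chi>\<close> to \<open>q\<close>?'', since the answer of a
  non-random god to \<open>q\<close> is a function of the state.\<close>

type_synonym 'g question = "'g state \<Rightarrow> bool"

definition word_for :: "'g state \<Rightarrow> bool \<Rightarrow> word" where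
  "word_for s b = (if b = chi_means_yes s then Chi else Other)"

definition may_answer :: "'g state \<Rightarrow> 'g \<Rightarrow> 'g question \<Rightarrow> word \<Rightarrow> bool" where
  "may_answer s g q w \<longleftrightarrow>
     (case type_of s g of
        Truthful \<Rightarrow> w = word_for s (q s)
      | Lying \<Rightarrow> w = word_for s (\<not> q s)
      | Random \<Rightarrow> True)"

text \<open>The questions are asked at the stages of a well-order \<open>r\<close> of arbitrary length. A strategy
  chooses the god and the question from the history, that is, from the answers at all earlier
  stages; the domain of the history determines the current stage. Every run has the full length
  of \<open>r\<close>: a solver who is done early can ask further questions and ignore the answers.\<close>

type_synonym ('i, 'g) strategy = "('i \<rightharpoonup> word) \<Rightarrow> 'g \<times> 'g question"

definition possible_run :: "'i rel \<Rightarrow> ('i, 'g) strategy \<Rightarrow> 'g state \<Rightarrow> ('i \<rightharpoonup> word) \<Rightarrow> bool" where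
  "possible_run r \<sigma> s a \<longleftrightarrow>
     dom a = Field r \<and>
     (\<forall>i \<in> Field r. case \<sigma> (a |` underS r i) of (g, q) \<Rightarrow> may_answer s g q (the (a i)))"

definition admissible :: "'g rel \<Rightarrow> 'g rel \<Rightarrow> 'g rel \<Rightarrow> 'g state \<Rightarrow> bool" where
  "admissible \<kappa>R \<kappa>T \<kappa>F s \<longleftrightarrow>
     |{g. type_of s g = Random}| =o \<kappa>R \<and>
     |{g. type_of s g = Truthful}| =o \<kappa>T \<and>
     |{g. type_of s g = Lying}| =o \<kappa>F"

text \<open>HOL cannot quantify over types, so the type \<open>'i\<close> from which the stages are drawn is a
  parameter; with \<open>'i\<close> arbitrary subject to being infinite and at least as large as \<open>'g\<close>,
  the number of questions is unrestricted. The function \<open>verdict\<close> reads off the types of all gods from the answers.\<close>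

definition solvable :: "'i itself \<Rightarrow> 'g rel \<Rightarrow> 'g rel \<Rightarrow> 'g rel \<Rightarrow> bool" where
  "solvable (_ :: 'i itself) \<kappa>R \<kappa>T \<kappa>F \<longleftrightarrow>
     (\<exists>(r :: 'i rel) (\<sigma> :: ('i, 'g) strategy) (verdict :: ('i \<rightharpoonup> word) \<Rightarrow> 'g \<Rightarrow> god_type).
        Well_order r \<and>
        (\<forall>s a. admissible \<kappa>R \<kappa>T \<kappa>F s \<longrightarrow> possible_run r \<sigma> s a \<longrightarrow> verdict a = type_of s))"

end

theory Submission
  imports Defs
begin

text \<open>
  \<^emph>\<open>Few random gods.\<close> The unknown language and the unknown honesty of a non-random god can both
  be cancelled: asked whether \<open>P\<close> is equivalent to ``you are truthful if and only if \<open>\<chi>\<close> means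
  yes'', every non-random god says \<open>\<chi>\<close> exactly when \<open>P\<close> holds (\<open>chi_iff\<close>). The solver puts this
  question about every \<open>P\<close> of the form ``the type of \<open>h\<close> is \<open>t\<close>'' to every god. When \<open>P\<close> is
  true, only random gods can dissent; when \<open>P\<close> is false, all non-random gods do. As
  there are strictly fewer random than non-random gods, the cardinality of the dissenters decides
  \<open>P\<close> (\<open>few_dissenters_iff\<close>). This comparison replaces a majority vote and treats finite
  and infinite numbers of gods alike. No adaptivity is involved.

  \<^emph>\<open>Many random gods.\<close> If the non-random gods inject into the random ones, then exchanging
  each non-random god with its image turns any state into another state with the same cardinalities
  whose non-random gods are all random in the original one (\<open>disjoint_rearrangement\<close>). No god
  is then bound by both states, so whatever the solver asks, each answer can be chosen to be possible in
  both (\<open>common_run\<close>), and the solver cannot tell the two states apart. They do differ, because some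
  god is non-random.
\<close>

definition nonrandom :: "'g state \<Rightarrow> 'g set" where
  "nonrandom s = {g. type_of s g \<noteq> Random}"

section \<open>Counting the gods of an admissible state\<close>

lemma card_of_nonrandom:
  assumes "admissible \<kappa>R \<kappa>T \<kappa>F s"
  shows "|nonrandom s| =o \<kappa>T +c \<kappa>F"
proof -
  let ?T = "{g. type_of s g = Truthful}" and ?F = "{g. type_of s g = Lying}"
  have "type_of s g \<noteq> Random \<longleftrightarrow> type_of s g = Truthful \<or> type_of s g = Lying" for g
    by (cases "type_of s g") simp_all
  then have "bij_betw (case_sum id id) (?T <+> ?F) (nonrandom s)"
    by (auto simp: bij_betw_def inj_on_def nonrandom_def image_Un Plus_def image_image)
  then have "|nonrandom s| =o |?T <+> ?F|"
    using card_of_ordIso ordIso_symmetric by blast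
  moreover have "|?T <+> ?F| =o |?T| +c |?F|"
    by (rule Plus_csum)
  moreover have "|?T| +c |?F| =o \<kappa>T +c \<kappa>F"
    using assms unfolding admissible_def by (intro csum_cong) auto
  ultimately show ?thesis
    by (blast intro: ordIso_transitive)
qed

text \<open>If no state had the given cardinalities, the puzzle would be vacuously solvable, so the
  rearrangement argument needs one state to start from.\<close>

lemma admissible_state_exists:
  fixes \<kappa>R \<kappa>T \<kappa>F :: "'g rel"
  assumes "Card_order \<kappa>R" and "Card_order \<kappa>T" and "Card_order \<kappa>F"
    and "\<kappa>R +c (\<kappa>T +c \<kappa>F) =o |UNIV :: 'g set|"
  shows "\<exists>s :: 'g state. admissible \<kappa>R \<kappa>T \<kappa>F s"
proof -
  let ?A = "Field \<kappa>R <+> (Field \<kappa>T <+> Field \<kappa>F)"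
  have "|?A| =o |UNIV :: 'g set|"
    using assms(4) by (simp add: csum_def Field_card_of)
  then obtain f where f: "bij_betw f ?A (UNIV :: 'g set)"
    using card_of_ordIso by blast
  define kind :: "'g + ('g + 'g) \<Rightarrow> god_type"
    where "kind = case_sum (\<lambda>_. Random) (case_sum (\<lambda>_. Truthful) (\<lambda>_. Lying))"
  define s where "s = State (\<lambda>g. kind (inv_into ?A f g)) True"
  have type_s: "type_of s (f x) = kind x" if "x \<in> ?A" for x
    using that f by (simp add: s_def bij_betw_def inv_into_f_f)
  have image: "{g. type_of s g = t} = f ` {x \<in> ?A. kind x = t}" for t
  proof -
    have "{g. type_of s g = t} = {g \<in> f ` ?A. type_of s g = t}"
      using bij_betw_imp_surj_on[OF f] by simp
    also have "\<dots> = f ` {x \<in> ?A. type_of s (f x) = t}"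
      by (simp only: Compr_image_eq)
    also have "{x \<in> ?A. type_of s (f x) = t} = {x \<in> ?A. kind x = t}"
      using type_s by (intro Collect_cong conj_cong) simp_all
    finally show ?thesis .
  qed
  have count: "|{g. type_of s g = t}| =o r"
    if "{x \<in> ?A. kind x = t} = c ` Field r" "inj c" "Card_order r"
    for t r and c :: "'g \<Rightarrow> 'g + ('g + 'g)"
  proof -
    have "inj_on f (c ` Field r)"
      using f that(1) by (auto simp: bij_betw_def intro: inj_on_subset)
    then have "bij_betw (f \<circ> c) (Field r) {g. type_of s g = t}"
      unfolding image that(1) bij_betw_def using \<open>inj c\<close>
      by (auto intro: comp_inj_on inj_on_subset simp: image_comp)
    then have "|Field r| =o |{g. type_of s g = t}|"
      using card_of_ordIso by blast
    then show ?thesis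
      using card_of_Field_ordIso[OF \<open>Card_order r\<close>] ordIso_symmetric ordIso_transitive by blast
  qed
  have "admissible \<kappa>R \<kappa>T \<kappa>F s"
    unfolding admissible_def
  proof (intro conjI)
    show "|{g. type_of s g = Random}| =o \<kappa>R"
      by (rule count[where c = Inl]) (use assms(1) in \<open>auto simp: kind_def\<close>)
    show "|{g. type_of s g = Truthful}| =o \<kappa>T"
      by (rule count[where c = "Inr \<circ> Inl"])
        (use assms(2) in \<open>auto simp: kind_def image_iff intro: injI\<close>)
    show "|{g. type_of s g = Lying}| =o \<kappa>F"
      by (rule count[where c = "Inr \<circ> Inr"])
        (use assms(3) in \<open>auto simp: kind_def image_iff intro: injI\<close>)
  qed
  then show ?thesis ..
qed

section \<open>Solving the puzzle when random gods are fewer\<close>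

text \<open>The right-hand equivalence is the parity of the two unknowns (honesty and meaning of \<open>\<chi>\<close>),
  each of which flips the answer; including it in the question cancels both flips.\<close>

definition chi_iff :: "('g state \<Rightarrow> bool) \<Rightarrow> 'g \<Rightarrow> 'g question" where
  "chi_iff P g s \<longleftrightarrow> (P s \<longleftrightarrow> (type_of s g = Truthful \<longleftrightarrow> chi_means_yes s))"

lemma may_answer_chi_iff:
  assumes "may_answer s g (chi_iff P g) w" and "g \<in> nonrandom s"
  shows "w = Chi \<longleftrightarrow> P s"
  using assms
  by (cases "type_of s g")
    (auto simp: may_answer_def chi_iff_def nonrandom_def word_for_def split: if_splits)

lemma few_dissenters_iff:
  fixes \<kappa> :: "'k rel"
  assumes answers: "\<And>g. may_answer s g (chi_iff P g) (w g)"
    and nonrandom: "|nonrandom s| =o \<kappa>"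
    and few_random: "|- nonrandom s| <o \<kappa>"
  shows "|{g. w g \<noteq> Chi}| <o \<kappa> \<longleftrightarrow> P s"
proof
  assume "P s"
  then have "{g. w g \<noteq> Chi} \<subseteq> - nonrandom s"
    using may_answer_chi_iff[OF answers] by auto
  then show "|{g. w g \<noteq> Chi}| <o \<kappa>"
    using few_random card_of_mono1 ordLeq_ordLess_trans by blast
next
  assume few: "|{g. w g \<noteq> Chi}| <o \<kappa>"
  show "P s"
  proof (rule ccontr)
    assume "\<not> P s"
    then have "nonrandom s \<subseteq> {g. w g \<noteq> Chi}"
      using may_answer_chi_iff[OF answers] by auto
    then have "\<kappa> \<le>o |{g. w g \<noteq> Chi}|"
      using nonrandom card_of_mono1 ordIso_symmetric ordIso_ordLeq_trans by blast
    with few show False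
      using not_ordLess_ordLeq by blast
  qed
qed

text \<open>A strategy sees only the history, but a stage of a well-order is determined by the set of its
  predecessors, so any list of questions fixed in advance can be asked.\<close>

lemma predetermined_strategy:
  fixes r :: "'i rel" and Q :: "'i \<Rightarrow> 'g \<times> 'g question"
  assumes "Well_order r"
  obtains \<sigma> :: "('i, 'g) strategy"
  where "\<And>a i. dom a = Field r \<Longrightarrow> i \<in> Field r \<Longrightarrow> \<sigma> (a |` underS r i) = Q i"
proof
  have unique: "i = j" if "i \<in> Field r" "j \<in> Field r" "underS r i = underS r j" for i j
  proof (rule ccontr)
    assume "i \<noteq> j"
    moreover have "(i, j) \<in> r \<or> (j, i) \<in> r"
      using assms that \<open>i \<noteq> j\<close> by (auto simp: order_on_defs total_on_def)
    ultimately show False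
      using that(3) by (auto simp: underS_def)
  qed
  fix a :: "'i \<rightharpoonup> word" and i
  assume a: "dom a = Field r" and i: "i \<in> Field r"
  have "underS r i \<subseteq> Field r"
    by (auto simp: underS_def Field_def)
  then have "dom (a |` underS r i) = underS r i"
    using a by auto
  moreover have "(THE j. j \<in> Field r \<and> underS r j = underS r i) = i"
    by (rule the_equality) (use i unique in auto)
  ultimately show "(\<lambda>h. Q (THE j. j \<in> Field r \<and> underS r j = dom h)) (a |` underS r i) = Q i"
    by simp
qed

lemma stages_for_questions:
  assumes "infinite (UNIV :: 'i set)" and "|UNIV :: 'g set| \<le>o |UNIV :: 'i set|"
  obtains e :: "'g \<times> 'g \<times> god_type \<Rightarrow> 'i" where "inj e"
proof -
  have "(UNIV :: god_type set) = {Truthful, Lying, Random}"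
    using god_type.exhaust by auto
  then have "finite (UNIV :: god_type set)"
    by (metis finite.emptyI finite.insertI)
  then have "|UNIV :: god_type set| \<le>o |UNIV :: 'i set|"
    using assms(1) by (intro ordLess_imp_ordLeq finite_ordLess_infinite)
      (auto simp: Field_card_of card_of_well_order_on)
  then have "|(UNIV :: 'g set) \<times> (UNIV :: 'g set) \<times> (UNIV :: god_type set)| \<le>o |UNIV :: 'i set|"
    using assms by (intro card_of_Sigma_ordLeq_infinite ballI)
  then show thesis
    using that card_of_ordLeq[of UNIV "UNIV :: 'i set"] by (auto simp: UNIV_Times_UNIV)
qed

lemma solvable_if_fewer_random:
  fixes \<kappa>R \<kappa>T \<kappa>F :: "'g rel"
  assumes "infinite (UNIV :: 'i set)" and "|UNIV :: 'g set| \<le>o |UNIV :: 'i set|"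
    and fewer: "\<kappa>R <o \<kappa>T +c \<kappa>F"
  shows "solvable TYPE('i) \<kappa>R \<kappa>T \<kappa>F"
proof -
  obtain e :: "'g \<times> 'g \<times> god_type \<Rightarrow> 'i" where e: "inj e"
    using stages_for_questions assms(1,2) by blast
  obtain r :: "'i rel" where r: "well_order_on UNIV r"
    using well_order_on by blast
  then have Field_r: "Field r = UNIV" and wo: "Well_order r"
    using well_order_on_Well_order by auto
  \<comment> \<open>A stage outside the range of \<open>e\<close> merely repeats some question, since \<open>inv e\<close> is total; the
    verdict ignores its answer.\<close>
  define Q where
    "Q i = (case inv e i of (g, h, t) \<Rightarrow> (g, chi_iff (\<lambda>s. type_of s h = t) g))" for i
  obtain \<sigma> :: "('i, 'g) strategy" where
    \<sigma>: "\<And>a i. dom a = Field r \<Longrightarrow> i \<in> Field r \<Longrightarrow> \<sigma> (a |` underS r i) = Q i"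
    using predetermined_strategy[OF wo, of Q] by blast
  define verdict where
    "verdict a h = (THE t. |{g. the (a (e (g, h, t))) \<noteq> Chi}| <o \<kappa>T +c \<kappa>F)"
    for a :: "'i \<rightharpoonup> word" and h
  have "verdict a h = type_of s h"
    if s: "admissible \<kappa>R \<kappa>T \<kappa>F s" and run: "possible_run r \<sigma> s a" for s a h
  proof -
    have answers: "may_answer s g (chi_iff (\<lambda>s. type_of s h = t) g) (the (a (e (g, h, t))))" for g t
    proof -
      have "dom a = Field r" and "\<sigma> (a |` underS r (e (g, h, t))) = Q (e (g, h, t))"
        using run \<sigma> Field_r by (auto simp: possible_run_def)
      moreover have "Q (e (g, h, t)) = (g, chi_iff (\<lambda>s. type_of s h = t) g)"
        using e by (simp add: Q_def inv_f_f)
      ultimately show ?thesis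
        using run Field_r unfolding possible_run_def by (metis UNIV_I case_prod_conv)
    qed
    have few_random: "|- nonrandom s| <o \<kappa>T +c \<kappa>F"
    proof -
      have "- nonrandom s = {g. type_of s g = Random}"
        by (auto simp: nonrandom_def)
      then show ?thesis
        using s fewer unfolding admissible_def by (auto intro: ordIso_ordLess_trans)
    qed
    have
      "|{g. the (a (e (g, h, t))) \<noteq> Chi}| <o \<kappa>T +c \<kappa>F \<longleftrightarrow> type_of s h = t" for t
      using answers card_of_nonrandom[OF s] few_random by (rule few_dissenters_iff)
    then show ?thesis
      by (simp add: verdict_def)
  qed
  then have "\<forall>s a. admissible \<kappa>R \<kappa>T \<kappa>F s \<longrightarrow> possible_run r \<sigma> s a \<longrightarrow> verdict a = type_of s"
    by (intro allI impI ext)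
  with wo show ?thesis
    unfolding solvable_def by (intro exI conjI)
qed

section \<open>Defeating every strategy when random gods are not fewer\<close>

text \<open>Composing the types with an involution that exchanges each non-random god with its image under
  an injection into the random gods preserves all three cardinalities.\<close>

lemma disjoint_rearrangement:
  assumes s: "admissible \<kappa>R \<kappa>T \<kappa>F s"
    and many_random: "|nonrandom s| \<le>o |- nonrandom s|"
  obtains s' where "admissible \<kappa>R \<kappa>T \<kappa>F s'" and "nonrandom s \<inter> nonrandom s' = {}"
proof -
  let ?N = "nonrandom s"
  obtain j where j: "inj_on j ?N" "j ` ?N \<subseteq> - ?N"
    using many_random card_of_ordLeq by metis
  define \<pi> where
    "\<pi> g = (if g \<in> ?N then j g else if g \<in> j ` ?N then inv_into ?N j g else g)" for g
  have involution: "\<pi> (\<pi> g) = g" for g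
    using j by (auto simp: \<pi>_def)
  then have "bij \<pi>"
    by (rule involuntory_imp_bij)
  define s' where "s' = State (type_of s \<circ> \<pi>) True"
  have "|{g. type_of s' g = t}| =o |{g. type_of s g = t}|" for t
  proof -
    have "{g. type_of s g = t} = \<pi> ` {g. type_of s' g = t}"
    proof -
      have "g \<in> \<pi> ` {g. type_of s' g = t}" if "type_of s g = t" for g
        using that involution[of g] by (intro image_eqI[of _ _ "\<pi> g"]) (auto simp: s'_def)
      then show ?thesis
        by (auto simp: s'_def)
    qed
    then have "bij_betw \<pi> {g. type_of s' g = t} {g. type_of s g = t}"
      using \<open>bij \<pi>\<close> by (auto simp: bij_betw_def intro: inj_on_subset)
    then show ?thesis
      using card_of_ordIso by blast
  qed
  then have "admissible \<kappa>R \<kappa>T \<kappa>F s'"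
    using s unfolding admissible_def by (blast intro: ordIso_transitive)
  moreover have "?N \<inter> nonrandom s' = {}"
    using j by (auto simp: nonrandom_def s'_def \<pi>_def)
  ultimately show thesis
    by (rule that)
qed

text \<open>The answers are built by transfinite recursion along the stages; each question binds the
  answer in at most one of the two states.\<close>

lemma common_run:
  fixes r :: "'i rel"
  assumes wo: "Well_order r" and disjoint: "nonrandom s \<inter> nonrandom s' = {}"
  obtains a where "possible_run r \<sigma> s a" and "possible_run r \<sigma> s' a"
proof -
  interpret wo_rel r
    using wo by (simp add: wo_rel_def)
  have possible: "\<exists>w. may_answer s g q w \<and> may_answer s' g q w" for g q
  proof -
    have "\<exists>w. may_answer t g q w" for t
      by (cases "type_of t g") (simp_all add: may_answer_def)
    moreover have "type_of s g = Random \<or> type_of s' g = Random"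
      using disjoint by (auto simp: nonrandom_def)
    moreover have "may_answer t g q w" if "type_of t g = Random" for t w
      using that by (simp add: may_answer_def)
    ultimately show ?thesis
      by metis
  qed
  define reply where
    "reply = (\<lambda>(g, q). SOME w. may_answer s g q w \<and> may_answer s' g q w)"
  have reply: "may_answer s g q (reply (g, q))" "may_answer s' g q (reply (g, q))" for g q
    using someI_ex[OF possible] by (auto simp: reply_def)
  define H where
    "H a i = (if i \<in> Field r then Some (reply (\<sigma> (a |` underS i))) else None)" for a i
  have "adm_wo H"
    unfolding adm_wo_def
  proof (intro allI impI)
    fix a b :: "'i \<rightharpoonup> word" and i
    assume "\<forall>y \<in> underS i. a y = b y"
    then have "a |` underS i = b |` underS i"
      by (auto simp: restrict_map_def)
    then show "H a i = H b i"
      by (simp add: H_def)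
  qed
  then have fixpoint: "worec H = H (worec H)"
    by (rule worec_fixpoint)
  define a where "a = worec H"
  have a: "a i = (if i \<in> Field r then Some (reply (\<sigma> (a |` underS i))) else None)" for i
    using fun_cong[OF fixpoint, of i] by (simp add: a_def H_def)
  have "dom a = Field r"
    using a by (auto split: if_splits)
  moreover have "the (a i) = reply (\<sigma> (a |` underS i))" if "i \<in> Field r" for i
    using a that by simp
  ultimately have "possible_run r \<sigma> s a" "possible_run r \<sigma> s' a"
    using reply by (simp_all add: possible_run_def split: prod.split)
  then show thesis
    by (rule that)
qed

lemma not_solvable_if_disjoint_states:
  fixes s s' :: "'g state"
  assumes "admissible \<kappa>R \<kappa>T \<kappa>F s" and "admissible \<kappa>R \<kappa>T \<kappa>F s'"
    and disjoint: "nonrandom s \<inter> nonrandom s' = {}" and "nonrandom s \<noteq> {}"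
  shows "\<not> solvable TYPE('i) \<kappa>R \<kappa>T \<kappa>F"
proof
  assume "solvable TYPE('i) \<kappa>R \<kappa>T \<kappa>F"
  then obtain r :: "'i rel" and \<sigma> verdict where wo: "Well_order r"
    and sound: "\<And>s a. admissible \<kappa>R \<kappa>T \<kappa>F s \<Longrightarrow> possible_run r \<sigma> s a \<Longrightarrow> verdict a = type_of s"
    unfolding solvable_def by blast
  obtain a where "possible_run r \<sigma> s a" and "possible_run r \<sigma> s' a"
    using common_run[OF wo disjoint] by blast
  then have "type_of s = type_of s'"
    using sound assms(1,2) by metis
  then have "nonrandom s = nonrandom s'"
    by (simp add: nonrandom_def)
  then show False
    using assms(3,4) by simp
qed

theorem theorem11p2:
  fixes \<kappa>R \<kappa>T \<kappa>F :: "'g rel"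
  assumes "Card_order \<kappa>R" and "Card_order \<kappa>T" and "Card_order \<kappa>F"
    and "\<kappa>R +c (\<kappa>T +c \<kappa>F) =o |UNIV :: 'g set|"
    and nonrandom_exists: "Field (\<kappa>T +c \<kappa>F) \<noteq> {}"
    and enough_stages: "infinite (UNIV :: 'i set)" "|UNIV :: 'g set| \<le>o |UNIV :: 'i set|"
  shows "solvable TYPE('i) \<kappa>R \<kappa>T \<kappa>F \<longleftrightarrow> \<kappa>R <o \<kappa>T +c \<kappa>F"
proof
  assume "\<kappa>R <o \<kappa>T +c \<kappa>F"
  then show "solvable TYPE('i) \<kappa>R \<kappa>T \<kappa>F"
    using solvable_if_fewer_random enough_stages by blast
next
  assume solvable: "solvable TYPE('i) \<kappa>R \<kappa>T \<kappa>F"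
  show "\<kappa>R <o \<kappa>T +c \<kappa>F"
  proof (rule ccontr)
    assume "\<not> \<kappa>R <o \<kappa>T +c \<kappa>F"
    then have many: "\<kappa>T +c \<kappa>F \<le>o \<kappa>R"
      using assms(1) Card_order_csum not_ordLess_iff_ordLeq unfolding card_order_on_def by blast
    obtain s :: "'g state" where s: "admissible \<kappa>R \<kappa>T \<kappa>F s"
      using admissible_state_exists assms(1-4) by blast
    have nonrandom: "|nonrandom s| =o \<kappa>T +c \<kappa>F"
      using s by (rule card_of_nonrandom)
    have "- nonrandom s = {g. type_of s g = Random}"
      by (auto simp: nonrandom_def)
    then have "|- nonrandom s| =o \<kappa>R"
      using s by (simp add: admissible_def)
    then have "|nonrandom s| \<le>o |- nonrandom s|"
      using nonrandom many
      by (meson ordIso_ordLeq_trans ordIso_symmetric ordLeq_ordIso_trans)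
    then obtain s' where "admissible \<kappa>R \<kappa>T \<kappa>F s'" and "nonrandom s \<inter> nonrandom s' = {}"
      using disjoint_rearrangement[OF s] by blast
    moreover have "nonrandom s \<noteq> {}"
    proof
      assume "nonrandom s = {}"
      then have "|Field (\<kappa>T +c \<kappa>F)| =o |{} :: 'g set|"
        using nonrandom card_of_Field_ordIso[OF Card_order_csum]
        by (metis ordIso_symmetric ordIso_transitive)
      then show False
        using nonrandom_exists card_of_empty2 by blast
    qed
    ultimately show False
      using not_solvable_if_disjoint_states[OF s] solvable by blast
  qed
qed

end
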